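(* Let $n\in\mathbb{N}$ be arbitrary but fixed, and let $x_i, v_i:\mathbb{R}\to\mathbb{R}^3$, $i=1,\ldots,n$, be a solution of the repulsive $n$-body system $$\dot x_i = v_i,\qquad \dot v_i=\sum_{j=1,\ldots,n,\ j\neq i}\frac{x_i-x_j}{|x_i-x_j|^3},\qquad i=1,\ldots,n.$$ Let $E_{\mathrm{pot}}(t)$ be its potential energy and $E_{\mathrm{kin}}^{\mathrm{rel}}(t)$ its relative kinetic energy (defined in the context). Then: (a) For all $t\in\mathbb{R}$, $$\frac{d}{dt}\left[t^2E_{\mathrm{kin}}^{\mathrm{rel}}(t)+t^2E_{\mathrm{pot}}(t)\right]=t\,E_{\mathrm{pot}}(t).$$ (b) For all $t\ge 1$, $$E_{\mathrm{kin}}^{\mathrm{rel}}(t)+E_{\mathrm{pot}}(t)=\frac{C}{t}-\frac1t\int_1^tE_{\mathrm{kin}}^{\mathrm{rel}}(s)\,ds$$ with $C>0$ independent of $t$.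
   Context: The system describes $n$ point charges of equal sign, with unit charge and unit mass, with positions $x_i(t)\in\mathbb{R}^3$ and velocities $v_i(t)\in\mathbb{R}^3$ depending on time $t\in\mathbb{R}$; $|\cdot|$ is the Euclidean norm. By conservation of energy, every solution exists for all $t\in\mathbb{R}$, with $x_i(t)\neq x_j(t)$ for $i\neq j$. For such a solution define the potential energy $$E_{\mathrm{pot}}(t):=\frac12\sum_{1\le i\neq j\le n}\frac{1}{|x_i(t)-x_j(t)|},$$ where the sum is over ordered pairs $(i,j)$ with $i\neq j$, and the relative kinetic energy $$E_{\mathrm{kin}}^{\mathrm{rel}}(t):=\frac12\sum_{1\le i\le n}\left|v_i(t)-\frac{x_i(t)}{t}\right|^2.$$ At $t=0$ the product $t^2E_{\mathrm{kin}}^{\mathrm{rel}}(t)$ is read as $\frac12\sum_{1\le i\le n}|t\,v_i(t)-x_i(t)|^2$, with which it coincides for $t\neq0$.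
   Formalization: In (b), C > 0 is asserted only for n ≥ 2, and C ≥ 0 for every n, because C > 0 fails for n = 0 and for n = 1 with x_1(t) = t w, v_1(t) = w, where both energies vanish for t ≥ 1 and so C = 0. *)

theory Defs
  imports "HOL-Analysis.Analysis"
begin

text \<open>
  The particles carry the labels \<open>1, \<dots>, n\<close>; the functions \<open>x i\<close>, \<open>v i\<close> are unconstrained for other
  labels. Absence of collisions is part of being a solution: the right-hand side of the system is
  only meaningful away from collisions, whereas division by zero is total in HOL.
\<close>

definition repulsive_solution ::
  "nat \<Rightarrow> (nat \<Rightarrow> real \<Rightarrow> real^3) \<Rightarrow> (nat \<Rightarrow> real \<Rightarrow> real^3) \<Rightarrow> bool" where
  "repulsive_solution n x v \<longleftrightarrow>
     (\<forall>t. \<forall>i\<in>{1..n}. \<forall>j\<in>{1..n}. i \<noteq> j \<longrightarrow> x i t \<noteq> x j t) \<and>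
     (\<forall>t. \<forall>i\<in>{1..n}. (x i has_vector_derivative v i t) (at t)) \<and>
     (\<forall>t. \<forall>i\<in>{1..n}.
        (v i has_vector_derivative
           (\<Sum>j\<in>{1..n} - {i}. (x i t - x j t) /\<^sub>R norm (x i t - x j t) ^ 3)) (at t))"

definition E_pot :: "nat \<Rightarrow> (nat \<Rightarrow> real \<Rightarrow> real^3) \<Rightarrow> real \<Rightarrow> real" where
  "E_pot n x t = 1/2 * (\<Sum>i\<in>{1..n}. \<Sum>j\<in>{1..n} - {i}. 1 / norm (x i t - x j t))"

definition E_kin_rel ::
  "nat \<Rightarrow> (nat \<Rightarrow> real \<Rightarrow> real^3) \<Rightarrow> (nat \<Rightarrow> real \<Rightarrow> real^3) \<Rightarrow> real \<Rightarrow> real" where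
  "E_kin_rel n x v t = 1/2 * (\<Sum>i\<in>{1..n}. (norm (v i t - x i t /\<^sub>R t))\<^sup>2)"

text \<open>
  The product \<open>t\<^sup>2 E_kin_rel(t)\<close>, extended to \<open>t = 0\<close>, where the HOL value of \<open>x i t /\<^sub>R t\<close> is a
  meaningless \<open>0\<close>.
\<close>

definition sq_time_E_kin_rel ::
  "nat \<Rightarrow> (nat \<Rightarrow> real \<Rightarrow> real^3) \<Rightarrow> (nat \<Rightarrow> real \<Rightarrow> real^3) \<Rightarrow> real \<Rightarrow> real" where
  "sq_time_E_kin_rel n x v t =
     (if t = 0 then 1/2 * (\<Sum>i\<in>{1..n}. (norm (t *\<^sub>R v i t - x i t))\<^sup>2)
      else t\<^sup>2 * E_kin_rel n x v t)"

lemma sq_time_E_kin_rel_eq: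
  "sq_time_E_kin_rel n x v t = 1/2 * (\<Sum>i\<in>{1..n}. (norm (t *\<^sub>R v i t - x i t))\<^sup>2)"
proof (cases "t = 0")
  case False
  have "t\<^sup>2 * (norm (v i t - x i t /\<^sub>R t))\<^sup>2 = (norm (t *\<^sub>R v i t - x i t))\<^sup>2" for i
  proof -
    have "t *\<^sub>R v i t - x i t = t *\<^sub>R (v i t - x i t /\<^sub>R t)"
      using False by (simp add: scaleR_diff_right)
    then show ?thesis
      by (simp add: power_mult_distrib)
  qed
  with False show ?thesis
    by (simp add: sq_time_E_kin_rel_def E_kin_rel_def sum_distrib_left)
qed (simp add: sq_time_E_kin_rel_def)

end

theory Submission
  imports Defs
begin

text \<open>
  Differentiating \<open>t v\<^sub>i - x\<^sub>i\<close> cancels the velocity: the derivative is \<open>t\<close> times the acceleration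
  \<open>a\<^sub>i\<close>. Hence \<open>t\<^sup>2 E_kin_rel\<close> changes at the rate \<open>t\<^sup>2 \<Sum>\<^sub>i v\<^sub>i \<bullet> a\<^sub>i - t \<Sum>\<^sub>i x\<^sub>i \<bullet> a\<^sub>i\<close>. The first sum
  is the power of the forces, that is, minus the derivative of \<open>E_pot\<close>; the second is the virial,
  which for the Coulomb potential, homogeneous of degree \<open>-1\<close>, equals \<open>E_pot\<close>. Both sums are
  evaluated by Newton's third law: the lemma \<open>sum_inner_coulomb_accel\<close> rewrites them in terms of
  differences of pairs. Adding the derivative \<open>2 t E_pot + t\<^sup>2 E_pot'\<close> of \<open>t\<^sup>2 E_pot\<close> leaves
  \<open>t E_pot\<close>, which is (a).

  For (b), divide by \<open>t > 0\<close>: if \<open>F = t\<^sup>2 (E_kin_rel + E_pot)\<close>, then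
  \<open>(F / t)' = F' / t - F / t\<^sup>2 = E_pot - (E_kin_rel + E_pot) = - E_kin_rel\<close>, and the fundamental
  theorem of calculus on \<open>[1, t]\<close> gives the identity with \<open>C\<close> the value of \<open>E_kin_rel + E_pot\<close>
  at time \<open>1\<close>.
\<close>

definition coulomb_accel :: "nat \<Rightarrow> (nat \<Rightarrow> real^3) \<Rightarrow> nat \<Rightarrow> real^3" where
  "coulomb_accel n q i = (\<Sum>j\<in>{1..n} - {i}. (q i - q j) /\<^sub>R norm (q i - q j) ^ 3)"

lemma sum_off_diagonal_swap:
  fixes f :: "'a \<Rightarrow> 'a \<Rightarrow> 'b::comm_monoid_add"
  assumes "finite A"
  shows "(\<Sum>i\<in>A. \<Sum>j\<in>A - {i}. f i j) = (\<Sum>i\<in>A. \<Sum>j\<in>A - {i}. f j i)"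
proof -
  have "(\<Sum>i\<in>A. \<Sum>j\<in>A - {i}. f i j) = (\<Sum>i\<in>A. \<Sum>j | j \<in> A \<and> i \<noteq> j. f i j)"
    by (intro sum.cong) auto
  also have "\<dots> = (\<Sum>j\<in>A. \<Sum>i | i \<in> A \<and> i \<noteq> j. f i j)"
    by (rule sum.swap_restrict[OF assms assms])
  also have "\<dots> = (\<Sum>i\<in>A. \<Sum>j\<in>A - {i}. f j i)"
    by (intro sum.cong) auto
  finally show ?thesis .
qed

text \<open>
  Newton's third law: the pairs \<open>(i, j)\<close> and \<open>(j, i)\<close> contribute opposite forces, so weighting the
  accelerations by \<open>w\<close> only sees the differences \<open>w i - w j\<close>. It is used with the velocities
  (power) and with the positions (virial) as weights.
\<close>

lemma sum_inner_coulomb_accel: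
  "(\<Sum>i\<in>{1..n}. w i \<bullet> coulomb_accel n q i) =
   1/2 * (\<Sum>i\<in>{1..n}. \<Sum>j\<in>{1..n} - {i}.
            (w i - w j) \<bullet> (q i - q j) / norm (q i - q j) ^ 3)"
proof -
  define f where "f i j = (q i - q j) /\<^sub>R norm (q i - q j) ^ 3" for i j
  have anti: "f j i = - f i j" for i j
    unfolding f_def by (metis minus_diff_eq norm_minus_commute scaleR_minus_right)
  have lhs: "(\<Sum>i\<in>{1..n}. w i \<bullet> coulomb_accel n q i) = (\<Sum>i\<in>{1..n}. \<Sum>j\<in>{1..n} - {i}. w i \<bullet> f i j)"
    by (simp add: coulomb_accel_def f_def inner_sum_right)
  also have "\<dots> = (\<Sum>i\<in>{1..n}. \<Sum>j\<in>{1..n} - {i}. w j \<bullet> f j i)"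
    by (rule sum_off_diagonal_swap) simp
  also have "\<dots> = - (\<Sum>i\<in>{1..n}. \<Sum>j\<in>{1..n} - {i}. w j \<bullet> f i j)"
    by (subst anti) (simp add: sum_negf)
  finally have "2 * (\<Sum>i\<in>{1..n}. w i \<bullet> coulomb_accel n q i) =
      (\<Sum>i\<in>{1..n}. \<Sum>j\<in>{1..n} - {i}. w i \<bullet> f i j) - (\<Sum>i\<in>{1..n}. \<Sum>j\<in>{1..n} - {i}. w j \<bullet> f i j)"
    using lhs by simp
  also have "\<dots> = (\<Sum>i\<in>{1..n}. \<Sum>j\<in>{1..n} - {i}. (w i - w j) \<bullet> f i j)"
    by (simp add: sum_subtractf inner_diff_left)
  also have "\<dots> = (\<Sum>i\<in>{1..n}. \<Sum>j\<in>{1..n} - {i}. (w i - w j) \<bullet> (q i - q j) / norm (q i - q j) ^ 3)"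
    unfolding f_def inner_scaleR_right by (simp only: divide_inverse_commute)
  finally show ?thesis
    by simp
qed

lemma coulomb_virial:
  assumes "\<And>i j. i \<in> {1..n} \<Longrightarrow> j \<in> {1..n} \<Longrightarrow> i \<noteq> j \<Longrightarrow> x i t \<noteq> x j t"
  shows "(\<Sum>i\<in>{1..n}. x i t \<bullet> coulomb_accel n (\<lambda>i. x i t) i) = E_pot n x t"
proof -
  have "(x i t - x j t) \<bullet> (x i t - x j t) / norm (x i t - x j t) ^ 3 = 1 / norm (x i t - x j t)"
    if "i \<in> {1..n}" "j \<in> {1..n} - {i}" for i j
    using assms[of i j] that
    by (simp add: dot_square_norm power2_eq_square power3_eq_cube)
  then show ?thesis
    unfolding sum_inner_coulomb_accel E_pot_def by simp
qed

lemma has_real_derivative_inverse_norm: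
  fixes f :: "real \<Rightarrow> 'a::real_inner"
  assumes "(f has_vector_derivative f') (at t)" "f t \<noteq> 0"
  shows "((\<lambda>s. 1 / norm (f s)) has_real_derivative - (f' \<bullet> f t / norm (f t) ^ 3)) (at t)"
proof -
  have "((\<lambda>s. norm (f s)) has_derivative (\<lambda>h. (h *\<^sub>R f') \<bullet> sgn (f t))) (at t)"
    using has_derivative_compose[OF assms(1)[unfolded has_vector_derivative_def]
        has_derivative_norm[OF assms(2)]] .
  then have "((\<lambda>s. norm (f s)) has_real_derivative f' \<bullet> f t / norm (f t)) (at t)"
    unfolding has_field_derivative_def
    by (rule has_derivative_eq_rhs) (simp add: fun_eq_iff sgn_div_norm inner_commute field_simps)
  from DERIV_inverse'[OF this] assms(2) show ?thesis
    by (simp add: field_simps power3_eq_cube)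
qed

text \<open>Energy conservation in the form \<open>E_pot' = - power\<close>: the forces derive from \<open>E_pot\<close>.\<close>

lemma E_pot_has_real_derivative:
  assumes "\<And>i j. i \<in> {1..n} \<Longrightarrow> j \<in> {1..n} \<Longrightarrow> i \<noteq> j \<Longrightarrow> x i t \<noteq> x j t"
    and "\<And>i. i \<in> {1..n} \<Longrightarrow> (x i has_vector_derivative v i t) (at t)"
  shows "(E_pot n x has_real_derivative
           - (\<Sum>i\<in>{1..n}. v i t \<bullet> coulomb_accel n (\<lambda>i. x i t) i)) (at t)"
proof -
  have pair: "((\<lambda>s. 1 / norm (x i s - x j s)) has_real_derivative
        - ((v i t - v j t) \<bullet> (x i t - x j t) / norm (x i t - x j t) ^ 3)) (at t)"
    if "i \<in> {1..n}" "j \<in> {1..n} - {i}" for i j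
    using that assms
    by (intro has_real_derivative_inverse_norm has_vector_derivative_diff) auto
  have "((\<lambda>s. 1/2 * (\<Sum>i\<in>{1..n}. \<Sum>j\<in>{1..n} - {i}. 1 / norm (x i s - x j s)))
      has_real_derivative
        1/2 * (\<Sum>i\<in>{1..n}. \<Sum>j\<in>{1..n} - {i}.
          - ((v i t - v j t) \<bullet> (x i t - x j t) / norm (x i t - x j t) ^ 3))) (at t)"
    by (intro DERIV_cmult DERIV_sum pair)
  then show ?thesis
    unfolding sum_inner_coulomb_accel
    by (simp add: E_pot_def[abs_def] sum_negf)
qed

lemma sq_time_E_kin_rel_has_real_derivative:
  assumes "\<And>i. i \<in> {1..n} \<Longrightarrow> (x i has_vector_derivative v i t) (at t)"
    and "\<And>i. i \<in> {1..n} \<Longrightarrow> (v i has_vector_derivative a i) (at t)"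
  shows "(sq_time_E_kin_rel n x v has_real_derivative
           t\<^sup>2 * (\<Sum>i\<in>{1..n}. v i t \<bullet> a i) - t * (\<Sum>i\<in>{1..n}. x i t \<bullet> a i)) (at t)"
proof -
  have summand: "((\<lambda>s. (norm (s *\<^sub>R v i s - x i s))\<^sup>2) has_real_derivative
      2 * ((t *\<^sub>R v i t - x i t) \<bullet> (t *\<^sub>R a i))) (at t)" if i: "i \<in> {1..n}" for i
  proof -
    \<comment> \<open>The velocity from the factor \<open>s\<close> cancels the derivative of \<open>x i\<close>.\<close>
    have "((\<lambda>s. s *\<^sub>R v i s - x i s) has_vector_derivative t *\<^sub>R a i) (at t)"
      using has_vector_derivative_diff[OF has_vector_derivative_scaleR[OF DERIV_ident assms(2)[OF i]]
          assms(1)[OF i]] by simp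
    then have "((\<lambda>s. s *\<^sub>R v i s - x i s) has_derivative (\<lambda>h. h *\<^sub>R t *\<^sub>R a i)) (at t)"
      by (simp only: has_vector_derivative_def)
    from has_derivative_inner[OF this this] show ?thesis
      unfolding power2_norm_eq_inner has_field_derivative_def
      by (rule has_derivative_eq_rhs) (auto simp: fun_eq_iff inner_commute)
  qed
  have "((\<lambda>s. 1/2 * (\<Sum>i\<in>{1..n}. (norm (s *\<^sub>R v i s - x i s))\<^sup>2)) has_real_derivative
      1/2 * (\<Sum>i\<in>{1..n}. 2 * ((t *\<^sub>R v i t - x i t) \<bullet> (t *\<^sub>R a i)))) (at t)"
    by (intro DERIV_cmult DERIV_sum summand)
  also have "1/2 * (\<Sum>i\<in>{1..n}. 2 * ((t *\<^sub>R v i t - x i t) \<bullet> (t *\<^sub>R a i))) =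
      t\<^sup>2 * (\<Sum>i\<in>{1..n}. v i t \<bullet> a i) - t * (\<Sum>i\<in>{1..n}. x i t \<bullet> a i)"
    by (simp add: sum_distrib_left inner_diff_left right_diff_distrib sum_subtractf
        power2_eq_square mult.assoc)
  finally show ?thesis
    by (simp add: sq_time_E_kin_rel_eq[abs_def])
qed

lemma E_kin_rel_nonneg: "0 \<le> E_kin_rel n x v t"
  by (simp add: E_kin_rel_def sum_nonneg)

lemma E_pot_nonneg: "0 \<le> E_pot n x t"
  by (simp add: E_pot_def sum_nonneg)

lemma E_pot_pos:
  assumes "n \<ge> 2" and "x 1 t \<noteq> x 2 t"
  shows "0 < E_pot n x t"
proof -
  have "0 < 1 / norm (x 1 t - x 2 t)"
    using assms by simp
  also have "\<dots> \<le> (\<Sum>j\<in>{1..n} - {1}. 1 / norm (x 1 t - x j t))"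
    using assms by (intro member_le_sum[where f = "\<lambda>j. 1 / norm (x 1 t - x j t)"]) auto
  also have "\<dots> \<le> (\<Sum>i\<in>{1..n}. \<Sum>j\<in>{1..n} - {i}. 1 / norm (x i t - x j t))"
    using assms
    by (intro member_le_sum[where f = "\<lambda>i. \<Sum>j\<in>{1..n} - {i}. 1 / norm (x i t - x j t)"])
      (auto intro: sum_nonneg)
  finally show ?thesis
    by (simp add: E_pot_def)
qed

theorem mainTheorem1:
  fixes n :: nat
    and x v :: "nat \<Rightarrow> real \<Rightarrow> real^3"
  assumes "repulsive_solution n x v"
  shows "(\<forall>t. ((\<lambda>s. sq_time_E_kin_rel n x v s + s\<^sup>2 * E_pot n x s)
                 has_real_derivative t * E_pot n x t) (at t)) \<and>
         (\<exists>C::real. 0 \<le> C \<and> (n \<ge> 2 \<longrightarrow> 0 < C) \<and>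
            (\<forall>t\<ge>1. E_kin_rel n x v integrable_on {1..t} \<and>
                E_kin_rel n x v t + E_pot n x t
                  = C / t - 1 / t * integral {1..t} (E_kin_rel n x v)))"
proof -
  let ?F = "\<lambda>s. sq_time_E_kin_rel n x v s + s\<^sup>2 * E_pot n x s"
  let ?K = "E_kin_rel n x v" and ?P = "E_pot n x"
  have ne: "x i t \<noteq> x j t" if "i \<in> {1..n}" "j \<in> {1..n}" "i \<noteq> j" for i j t
    using assms that unfolding repulsive_solution_def by blast
  have dx: "(x i has_vector_derivative v i t) (at t)" if "i \<in> {1..n}" for i t
    using assms that unfolding repulsive_solution_def by blast
  have dv: "(v i has_vector_derivative coulomb_accel n (\<lambda>i. x i t) i) (at t)"
    if "i \<in> {1..n}" for i t
    using assms that unfolding repulsive_solution_def coulomb_accel_def by blast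

  have a: "(?F has_real_derivative t * ?P t) (at t)" for t
  proof -
    let ?a = "coulomb_accel n (\<lambda>i. x i t)"
    have K': "(sq_time_E_kin_rel n x v has_real_derivative
        t\<^sup>2 * (\<Sum>i\<in>{1..n}. v i t \<bullet> ?a i) - t * ?P t) (at t)"
      using sq_time_E_kin_rel_has_real_derivative[of n x v t ?a, OF dx dv]
        coulomb_virial[of n x t, OF ne] by simp
    have P': "(?P has_real_derivative - (\<Sum>i\<in>{1..n}. v i t \<bullet> ?a i)) (at t)"
      by (rule E_pot_has_real_derivative[of n x t v, OF ne dx])
    show ?thesis
      by (rule derivative_eq_intros K' P' refl)+ (simp add: algebra_simps)
  qed

  have F_eq: "?F s = s\<^sup>2 * (?K s + ?P s)" if "s > 0" for s
    using that by (simp add: sq_time_E_kin_rel_def algebra_simps)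
  have quot: "((\<lambda>s. ?F s / s) has_real_derivative - ?K s) (at s)" if "s > 0" for s
  proof -
    have "((\<lambda>s. ?F s / s) has_real_derivative (s * ?P s * s - ?F s * 1) / (s * s)) (at s)"
      using that by (intro DERIV_divide a DERIV_ident) auto
    also have "(s * ?P s * s - ?F s * 1) / (s * s) = - ?K s"
      unfolding F_eq[OF that] using that by (simp add: field_simps power2_eq_square)
    finally show ?thesis .
  qed

  define C where "C = ?K 1 + ?P 1"
  have b: "?K integrable_on {1..t} \<and> ?K t + ?P t = C / t - 1 / t * integral {1..t} ?K"
    if t: "t \<ge> 1" for t
  proof -
    have "((\<lambda>s. ?F s / s) has_vector_derivative - ?K s) (at s within {1..t})"
      if "s \<in> {1..t}" for s
      using has_field_derivative_at_within[OF quot[of s]] that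
      by (simp add: has_real_derivative_iff_has_vector_derivative)
    from fundamental_theorem_of_calculus[OF t this]
    have "((\<lambda>s. - ?K s) has_integral ?F t / t - ?F 1 / 1) {1..t}" .
    then have "((\<lambda>s. - ?K s) has_integral t * (?K t + ?P t) - C) {1..t}"
      using t by (simp only: F_eq[of t] F_eq[of 1] C_def) (simp add: power2_eq_square)
    from has_integral_neg[OF this] have I: "(?K has_integral C - t * (?K t + ?P t)) {1..t}"
      by simp
    then have "integral {1..t} ?K = C - t * (?K t + ?P t)"
      by (rule integral_unique)
    then have "?K t + ?P t = C / t - 1 / t * integral {1..t} ?K"
      using t by (simp add: field_simps)
    with I show ?thesis
      by blast
  qed

  have "0 \<le> C"
    using E_kin_rel_nonneg E_pot_nonneg by (simp add: C_def)
  moreover have "0 < C" if "n \<ge> 2"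
    using that E_kin_rel_nonneg[of n x v 1] E_pot_pos[of n x 1] ne[of 1 2 1] by (simp add: C_def)
  ultimately show ?thesis
    using a b by blast
qed

end
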